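(* Let $X$ and $Z$ be real reflexive Banach spaces and $K:X^*\to X$, $N:X\to X^*$, $H:Z\to X$ operators. Consider the system $$x=KNx+Hu,\qquad u\in Z,$$ with solution operator $T:Z\to X$, $Tu=x$, and a functional $\phi$. Suppose that: (a) at least one of the following two sets of conditions holds: Set A: (A1) $K$ is linear and compact and there is a constant $d>0$ with $\langle Kx,x\rangle\ge d\|Kx\|^2$ for all $x\in X^*$; (A2) $N$ is continuous, bounded and negatively monotone; (A3) $H$ is completely continuous. Set B: (B1) $K$ is linear and belongs to the class $\mathcal{M}$; (B2) $N$ is Lipschitz, $\mu(-N)>0$ and $(\mu(K)+\mu(-N))\,(\|N\|^{*})^{-2}>0$; (B3) $H$ is completely continuous. (b) $\phi:Z\times T(Z)\to\mathbb{R}$ is lower semicontinuous with respect to the weak topology in $Z$ and the norm topology in $T(Z)$, and $\phi(u,Tu)\to\infty$ as $\|u\|\to\infty$, $u\in Z$. Then the system has an optimal pair $(u^*,x^* )$, i.e. there is $u^*\in Z$ with $x^*=Tu^*$ and $\phi(u^*,x^* )=\inf_{u\in Z}\phi(u,Tu)$.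
   Context: Standing assumption: for each control $u\in Z$ the equation $x=KNx+Hu$ has a unique solution $x\in X$, and $T:Z\to X$ denotes the operator $u\mapsto x$. (The problem is unconstrained: the control set is the whole space $Z$.) $\langle\cdot,\cdot\rangle$ is the duality pairing. "Bounded" (for nonlinear maps) means mapping bounded sets to bounded sets. $N$ is negatively monotone if $\langle Nx-Ny,x-y\rangle\le 0$ for all $x,y$. $H$ is completely continuous if $u_n\rightharpoonup u$ weakly implies $Hu_n\to Hu$ in norm. Class $\mathcal{M}$: for a real Hilbert space $E$, $\mathcal{M}$ is the set of operators $P:E\to E$ such that $\langle Px_1-Px_2,x_1-x_2\rangle\ge\aleph_1\|x_1-x_2\|^2$ for all $x_1,x_2\in E$, with some positive constant $\aleph_1$. For an operator $P:E\to E$, $$\mu(P)=\inf_{x_1\ne x_2}\frac{\langle Px_1-Px_2,x_1-x_2\rangle}{\|x_1-x_2\|^2}.$$ When Set B is used, $X$ is a real Hilbert space identified with $X^*$. $\|N\|^{*}$ denotes the least Lipschitz constant of $N$. *)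

theory Defs
  imports "HOL-Analysis.Analysis"
begin

text \<open>
  The dual of a real normed space \<open>'a\<close> is \<open>'a \<Rightarrow>\<^sub>L real\<close> with the operator norm, and the duality
  pairing of \<open>f\<close> and \<open>x\<close> is \<open>blinfun_apply f x\<close>.
\<close>

text \<open>Surjectivity of the canonical embedding into the bidual.\<close>

definition reflexive_space :: "'a::real_normed_vector itself \<Rightarrow> bool" where
  "reflexive_space _ \<longleftrightarrow>
     (\<forall>F :: ('a \<Rightarrow>\<^sub>L real) \<Rightarrow>\<^sub>L real. \<exists>x::'a. \<forall>f. blinfun_apply F f = blinfun_apply f x)"

definition weak_topology :: "'a::real_normed_vector topology" where
  "weak_topology = topology_generated_by {blinfun_apply f -` U | (f :: 'a \<Rightarrow>\<^sub>L real) U. open U}"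

definition lower_semicontinuous_map :: "'a topology \<Rightarrow> ('a \<Rightarrow> real) \<Rightarrow> bool" where
  "lower_semicontinuous_map X f \<longleftrightarrow> (\<forall>a. openin X {x \<in> topspace X. a < f x})"


text \<open>None of the following operators is assumed to be linear unless this is said explicitly.\<close>

definition completely_continuous ::
    "('a::real_normed_vector \<Rightarrow> 'b::real_normed_vector) \<Rightarrow> bool" where
  "completely_continuous H \<longleftrightarrow>
     (\<forall>s u. limitin weak_topology s u sequentially \<longrightarrow> (\<lambda>n. H (s n)) \<longlonglongrightarrow> H u)"

definition compact_linear_operator ::
    "('a::real_normed_vector \<Rightarrow> 'b::real_normed_vector) \<Rightarrow> bool" where
  "compact_linear_operator K \<longleftrightarrow> linear K \<and> (\<forall>S. bounded S \<longrightarrow> compact (closure (K ` S)))"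

definition bounded_operator ::
    "('a::real_normed_vector \<Rightarrow> 'b::real_normed_vector) \<Rightarrow> bool" where
  "bounded_operator N \<longleftrightarrow> (\<forall>S. bounded S \<longrightarrow> bounded (N ` S))"

definition negatively_monotone :: "('a::real_normed_vector \<Rightarrow> ('a \<Rightarrow>\<^sub>L real)) \<Rightarrow> bool" where
  "negatively_monotone N \<longleftrightarrow> (\<forall>x y. blinfun_apply (N x - N y) (x - y) \<le> 0)"

text \<open>
  Unlike in \<open>real_inner\<close>, the inner product is a parameter: a Banach space \<open>'a\<close> is a Hilbert space
  if some \<open>ip\<close> satisfying the following induces its given norm.
\<close>

definition inner_product_for_norm :: "('a::real_normed_vector \<Rightarrow> 'a \<Rightarrow> real) \<Rightarrow> bool" where
  "inner_product_for_norm ip \<longleftrightarrow>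
     (\<forall>x y. ip x y = ip y x) \<and>
     (\<forall>x y z. ip (x + y) z = ip x z + ip y z) \<and>
     (\<forall>r x y. ip (r *\<^sub>R x) y = r * ip x y) \<and>
     (\<forall>x. 0 \<le> ip x x) \<and>
     (\<forall>x. ip x x = 0 \<longleftrightarrow> x = 0) \<and>
     (\<forall>x. norm x = sqrt (ip x x))"

text \<open>
  The Riesz isomorphism, along which a Hilbert space is identified with its dual. In a Hilbert space
  every \<open>ip x\<close> is bounded linear and \<open>riesz_map ip\<close> is bijective, so \<open>inv (riesz_map ip)\<close>
  is its genuine inverse.
\<close>

definition riesz_map :: "('a::real_normed_vector \<Rightarrow> 'a \<Rightarrow> real) \<Rightarrow> 'a \<Rightarrow> ('a \<Rightarrow>\<^sub>L real)" where
  "riesz_map ip x = Blinfun (ip x)"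

definition class_M :: "('a::real_normed_vector \<Rightarrow> 'a \<Rightarrow> real) \<Rightarrow> ('a \<Rightarrow> 'a) set" where
  "class_M ip = {P. \<exists>c>0. \<forall>x y. ip (P x - P y) (x - y) \<ge> c * (norm (x - y))\<^sup>2}"

text \<open>An extended real, since the infimum may be \<open>-\<infinity>\<close> (and is \<open>\<infinity>\<close> on the zero space).\<close>

definition mu :: "('a::real_normed_vector \<Rightarrow> 'a \<Rightarrow> real) \<Rightarrow> ('a \<Rightarrow> 'a) \<Rightarrow> ereal" where
  "mu ip P = Inf {ereal (ip (P x - P y) (x - y) / (norm (x - y))\<^sup>2) | x y. x \<noteq> y}"

definition least_lipschitz_const ::
    "('a::real_normed_vector \<Rightarrow> 'b::real_normed_vector) \<Rightarrow> real" where
  "least_lipschitz_const N = Inf {L. L-lipschitz_on UNIV N}"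


definition solution_operator ::
    "(('x::real_normed_vector \<Rightarrow>\<^sub>L real) \<Rightarrow> 'x) \<Rightarrow> ('x \<Rightarrow> ('x \<Rightarrow>\<^sub>L real)) \<Rightarrow> ('z \<Rightarrow> 'x) \<Rightarrow> 'z \<Rightarrow> 'x" where
  "solution_operator K N H u = (THE x. x = K (N x) + H u)"

definition condition_set_A ::
    "(('x::banach \<Rightarrow>\<^sub>L real) \<Rightarrow> 'x) \<Rightarrow> ('x \<Rightarrow> ('x \<Rightarrow>\<^sub>L real)) \<Rightarrow> ('z::banach \<Rightarrow> 'x) \<Rightarrow> bool" where
  "condition_set_A K N H \<longleftrightarrow>
     compact_linear_operator K \<and>
     (\<exists>d>0. \<forall>f. blinfun_apply f (K f) \<ge> d * (norm (K f))\<^sup>2) \<and>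
     continuous_on UNIV N \<and> bounded_operator N \<and> negatively_monotone N \<and>
     completely_continuous H"

text \<open>
  \<open>K'\<close> and \<open>N'\<close> are \<open>K\<close> and \<open>N\<close> regarded as operators from the Hilbert space to itself.
\<close>

definition condition_set_B ::
    "(('x::banach \<Rightarrow>\<^sub>L real) \<Rightarrow> 'x) \<Rightarrow> ('x \<Rightarrow> ('x \<Rightarrow>\<^sub>L real)) \<Rightarrow> ('z::banach \<Rightarrow> 'x) \<Rightarrow> bool" where
  "condition_set_B K N H \<longleftrightarrow>
     (\<exists>ip. inner_product_for_norm ip \<and>
       (let K' = (\<lambda>x. K (riesz_map ip x)); N' = (\<lambda>x. inv (riesz_map ip) (N x)) in
          linear K \<and> K' \<in> class_M ip \<and>
          (\<exists>L. L-lipschitz_on UNIV N') \<and>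
          mu ip (\<lambda>x. - N' x) > 0 \<and>
          (mu ip K' + mu ip (\<lambda>x. - N' x)) * inverse ((ereal (least_lipschitz_const N'))\<^sup>2) > 0 \<and>
          completely_continuous H))"

end

theory Submission
  imports Defs
begin

text \<open>
  The theorem is proved by the direct method. Coercivity confines a minimizing sequence of controls to a
  ball, reflexivity of the control space yields a weakly convergent subsequence, and lower
  semicontinuity passes to the limit as soon as the corresponding states converge in norm. Two things
  therefore carry the proof: the solution operator \<open>T\<close> is completely continuous, and bounded
  sequences in a reflexive space have weakly convergent subsequences.

  For the first, let \<open>u\<^sub>n\<close> converge weakly to \<open>u\<close>, and let \<open>x\<^sub>n = T u\<^sub>n\<close> and
  \<open>x = T u\<close>. With \<open>w = N x\<^sub>n - N x\<close> and \<open>h = H u\<^sub>n - H u\<close> the state equation gives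
  \<open>x\<^sub>n - x = K w + h\<close>; pairing with \<open>w\<close> and using the monotonicity of \<open>- N\<close> gives
  \<open>\<langle>w, K w\<rangle> + \<langle>w, h\<rangle> = \<langle>w, x\<^sub>n - x\<rangle> \<le> 0\<close>. Since \<open>H\<close> is completely continuous, \<open>h\<close>
  tends to zero in norm, and it remains to control \<open>w\<close>.
  In the case of Set A, the pairing \<open>\<langle>w, K w\<rangle>\<close> dominates only \<open>\<parallel>K w\<parallel>\<^sup>2\<close>, so
  a bound for \<open>w\<close> has to be known beforehand: the same computation, with \<open>x\<close> replaced by
  \<open>H u\<^sub>n\<close>, bounds the states, and \<open>N\<close> maps bounded sets to bounded sets
  (\<open>completely_continuous_solution_of_monotone_equation\<close>).
  In the case of Set B, \<open>\<langle>w, K w\<rangle>\<close> dominates \<open>\<parallel>w\<parallel>\<^sup>2\<close> itself, and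
  \<open>- \<langle>w, x\<^sub>n - x\<rangle>\<close> dominates \<open>\<parallel>x\<^sub>n - x\<parallel>\<^sup>2\<close>
  (\<open>completely_continuous_solution_of_strongly_monotone_equation\<close>). There \<open>K\<close> and \<open>N\<close>
  are read as operators on the Hilbert space, which is legitimate because the Riesz map is onto the dual
  (\<open>riesz_map_surj\<close>).

  The second is \<open>reflexive_bounded_weakly_convergent_subsequence\<close>. Everything in it is drawn
  from one form of the Hahn-Banach theorem: for a sublinear \<open>p\<close> and a point \<open>v\<close>, some linear
  functional lies below \<open>p\<close> and touches it at \<open>v\<close>
  (\<open>Hahn_Banach_sublinear\<close>). Applied to the norm and to the distance from a closed subspace it gives
  enough functionals, and applied, on the dual space, to the upper limit along the sequence it gives, by
  reflexivity, weak cluster points.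
\<close>

section \<open>The Hahn-Banach theorem\<close>

definition sublinear :: "('a::real_vector \<Rightarrow> real) \<Rightarrow> bool" where
  "sublinear p \<longleftrightarrow> (\<forall>x y. p (x + y) \<le> p x + p y) \<and> (\<forall>c\<ge>0. \<forall>x. p (c *\<^sub>R x) = c * p x)"

lemma sublinear_add: "sublinear p \<Longrightarrow> p (x + y) \<le> p x + p y"
  by (simp add: sublinear_def)

lemma sublinear_scaleR: "sublinear p \<Longrightarrow> 0 \<le> c \<Longrightarrow> p (c *\<^sub>R x) = c * p x"
  by (simp add: sublinear_def)

lemma sublinear_zero: "sublinear p \<Longrightarrow> p 0 = 0"
  using sublinear_scaleR[of p 0 0] by simp

lemma sublinear_minus: "sublinear p \<Longrightarrow> - p (- x) \<le> p x"
  using sublinear_add[of p x "- x"] sublinear_zero[of p] by simp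

lemma sublinearI:
  assumes add: "\<And>x y. p (x + y) \<le> p x + p y" and zero: "p 0 = 0"
    and scale: "\<And>c x. 0 < c \<Longrightarrow> p (c *\<^sub>R x) \<le> c * p x"
  shows "sublinear p"
  unfolding sublinear_def
proof (intro conjI allI impI)
  show "p (x + y) \<le> p x + p y" for x y by (rule add)
  fix c :: real and x :: 'a
  assume "0 \<le> c"
  show "p (c *\<^sub>R x) = c * p x"
  proof (cases "c = 0")
    case False
    then have c: "0 < c" using \<open>0 \<le> c\<close> by simp
    have "p x \<le> inverse c * p (c *\<^sub>R x)"
      using scale[of "inverse c" "c *\<^sub>R x"] c by simp
    then have "c * p x \<le> p (c *\<^sub>R x)"
      using c by (simp add: field_simps)
    then show ?thesis using scale[OF c, of x] by linarith
  qed (simp add: zero)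
qed

text \<open>
  Two infima of functionals have to be recognised as sublinear: the lower bound of a chain, and the
  distance to a subspace or the tilted functional below, where the individual \<open>g i\<close> are not
  sublinear. What they share is that the bounds for \<open>g i x\<close> and \<open>g j y\<close> are
  matched by some third member of the family.
\<close>

lemma sublinear_INF:
  fixes g :: "'i \<Rightarrow> 'a::real_vector \<Rightarrow> real"
  assumes I: "I \<noteq> {}" and bdd: "\<And>x. bdd_below ((\<lambda>i. g i x) ` I)"
    and zero: "(INF i\<in>I. g i 0) = 0"
    and add: "\<And>i j x y. i \<in> I \<Longrightarrow> j \<in> I \<Longrightarrow> \<exists>k\<in>I. g k (x + y) \<le> g i x + g j y"
    and scale: "\<And>i c x. i \<in> I \<Longrightarrow> 0 < c \<Longrightarrow> \<exists>k\<in>I. g k (c *\<^sub>R x) \<le> c * g i x"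
  shows "sublinear (\<lambda>x. INF i\<in>I. g i x)"
proof (rule sublinearI)
  have low: "(INF i\<in>I. g i x) \<le> g i x" if "i \<in> I" for i x
    by (rule cINF_lower[OF bdd that])
  show "(INF i\<in>I. g i 0) = 0" by (rule zero)
  fix x y :: 'a
  have "(INF i\<in>I. g i (x + y)) - g i x \<le> (INF j\<in>I. g j y)" if i: "i \<in> I" for i
  proof (rule cINF_greatest[OF I])
    fix j assume "j \<in> I"
    then obtain k where "k \<in> I" "g k (x + y) \<le> g i x + g j y" using add[OF i] by blast
    then show "(INF i\<in>I. g i (x + y)) - g i x \<le> g j y" using low[of k "x + y"] by linarith
  qed
  then have "(INF i\<in>I. g i (x + y)) - (INF j\<in>I. g j y) \<le> (INF i\<in>I. g i x)"
    by (intro cINF_greatest[OF I]) (simp add: algebra_simps)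
  then show "(INF i\<in>I. g i (x + y)) \<le> (INF i\<in>I. g i x) + (INF i\<in>I. g i y)" by linarith
next
  fix c :: real and x :: 'a
  assume c: "0 < c"
  have "(INF i\<in>I. g i (c *\<^sub>R x)) / c \<le> (INF i\<in>I. g i x)"
  proof (rule cINF_greatest[OF I])
    fix i assume "i \<in> I"
    then obtain k where "k \<in> I" "g k (c *\<^sub>R x) \<le> c * g i x" using scale c by blast
    then have "(INF i\<in>I. g i (c *\<^sub>R x)) \<le> c * g i x"
      using cINF_lower[OF bdd, of k "c *\<^sub>R x"] by linarith
    then show "(INF i\<in>I. g i (c *\<^sub>R x)) / c \<le> g i x" using c by (simp add: field_simps)
  qed
  then show "(INF i\<in>I. g i (c *\<^sub>R x)) \<le> c * (INF i\<in>I. g i x)"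
    using c by (simp add: field_simps)
qed

text \<open>
  Tilting \<open>p\<close> in the direction \<open>v\<close>: the infimum over \<open>t \<ge> 0\<close> of
  \<open>p (x + t v) - t p v\<close> is again sublinear, it stays below \<open>p\<close> (take \<open>t = 0\<close>),
  and at \<open>- v\<close> it has dropped as far as a functional that is linear along \<open>v\<close> must
  (take \<open>t = 1\<close>).
\<close>

lemma sublinear_tilt:
  fixes p :: "'a::real_vector \<Rightarrow> real"
  assumes p: "sublinear p"
  obtains q where "sublinear q" "\<And>x. q x \<le> p x" "q (- v) \<le> - p v"
proof
  let ?g = "\<lambda>t x. p (x + t *\<^sub>R v) - t * p v"
  let ?q = "\<lambda>x. INF t\<in>{0..}. ?g t x"
  have bdd: "bdd_below ((\<lambda>t. ?g t x) ` {0..})" for x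
  proof (rule bdd_belowI2)
    fix t :: real assume "t \<in> {0..}"
    then show "- p (- x) \<le> ?g t x"
      using sublinear_add[OF p, of "x + t *\<^sub>R v" "- x"] sublinear_scaleR[OF p, of t v] by simp
  qed
  have low: "?q x \<le> ?g t x" if "0 \<le> t" for t x
    using cINF_lower[OF bdd] that by fastforce
  show "sublinear ?q"
  proof (rule sublinear_INF[OF _ bdd])
    have "?g t 0 = 0" if "t \<in> {0..}" for t using that sublinear_scaleR[OF p] by simp
    then show "?q 0 = 0" by simp
    fix i j :: real and x y :: 'a
    assume ij: "i \<in> {0..}" "j \<in> {0..}"
    show "\<exists>k\<in>{0..}. ?g k (x + y) \<le> ?g i x + ?g j y"
      using ij sublinear_add[OF p, of "x + i *\<^sub>R v" "y + j *\<^sub>R v"]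
      by (intro bexI[of _ "i + j"]) (auto simp: algebra_simps)
    fix c :: real assume c: "0 < c"
    show "\<exists>k\<in>{0..}. ?g k (c *\<^sub>R x) \<le> c * ?g i x"
      using ij c sublinear_scaleR[OF p, of c "x + i *\<^sub>R v"]
      by (intro bexI[of _ "c * i"]) (auto simp: algebra_simps)
  qed simp
  show "?q x \<le> p x" for x using low[of 0 x] by simp
  show "?q (- v) \<le> - p v" using low[of 1 "- v"] sublinear_zero[OF p] by simp
qed

text \<open>
  Zorn's lemma for the reversed pointwise order. Chains have a lower bound because every sublinear
  \<open>q \<le> p\<close> satisfies \<open>q x \<ge> - q (- x) \<ge> - p (- x)\<close>, so that the pointwise
  infimum is finite.
\<close>

lemma minimal_sublinear_exists:
  fixes p :: "'a::real_vector \<Rightarrow> real"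
  assumes p: "sublinear p"
  obtains m where "sublinear m" "\<And>x. m x \<le> p x"
    "\<And>q. sublinear q \<Longrightarrow> (\<And>x. q x \<le> m x) \<Longrightarrow> q = m"
proof -
  define A where "A = {q. sublinear q \<and> (\<forall>x. q x \<le> p x)}"
  let ?R = "\<lambda>q q' :: 'a \<Rightarrow> real. q' \<le> q"
  have lower: "- p (- x) \<le> q x" if "q \<in> A" for q x
    using that sublinear_minus[of q x] unfolding A_def by (smt (verit) mem_Collect_eq)
  have "\<exists>m\<in>A. \<forall>q\<in>A. q \<le> m \<longrightarrow> q = m"
  proof (rule predicate_Zorn[of A ?R])
    show "partial_order_on A (relation_of ?R A)"
      by (rule partial_order_on_relation_ofI) auto
    fix C assume C: "C \<in> Chains (relation_of ?R A)"
    have CA: "C \<subseteq> A" and tot: "\<And>q r. q \<in> C \<Longrightarrow> r \<in> C \<Longrightarrow> q \<le> r \<or> r \<le> q"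
      using C by (auto simp: Chains_def relation_of_def)
    show "\<exists>u\<in>A. \<forall>a\<in>C. u \<le> a"
    proof (cases "C = {}")
      case True
      then show ?thesis using p by (auto simp: A_def)
    next
      case False
      let ?m = "\<lambda>x. INF q\<in>C. q x"
      have bdd: "bdd_below ((\<lambda>q. q x) ` C)" for x
        using lower CA by (intro bdd_belowI2[of _ "- p (- x)"]) auto
      have low: "?m x \<le> q x" if "q \<in> C" for q x
        using cINF_lower[OF bdd that] .
      have "sublinear ?m"
      proof (rule sublinear_INF[OF False bdd])
        have "q 0 = 0" if "q \<in> C" for q :: "'a \<Rightarrow> real" using that CA sublinear_zero by (auto simp: A_def)
        then have "(\<lambda>q. q 0) ` C = (\<lambda>q. 0) ` C" by (intro image_cong) auto
        then show "?m 0 = 0" using False by simp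
        fix q r :: "'a \<Rightarrow> real" and x y :: 'a
        assume q: "q \<in> C" and r: "r \<in> C"
        have sub: "sublinear q" "sublinear r" using q r CA by (auto simp: A_def)
        show "\<exists>k\<in>C. k (x + y) \<le> q x + r y"
          using tot[OF q r] sublinear_add[OF sub(1), of x y] sublinear_add[OF sub(2), of x y] q r
          by (smt (verit) le_funD)
        fix c :: real assume "0 < c"
        then show "\<exists>k\<in>C. k (c *\<^sub>R x) \<le> c * q x"
          using q sublinear_scaleR[OF sub(1), of c x] by (intro bexI[of _ q]) auto
      qed
      moreover have "?m x \<le> p x" for x
        using False low[of _ x] CA unfolding A_def
        by (metis (mono_tags, lifting) all_not_in_conv dual_order.trans mem_Collect_eq subset_iff)
      ultimately have "?m \<in> A" by (simp add: A_def)
      moreover have "\<forall>q\<in>C. ?m \<le> q" using low by (auto simp: le_fun_def)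
      ultimately show ?thesis by blast
    qed
  qed
  then obtain m where m: "m \<in> A" and min: "\<And>q. q \<in> A \<Longrightarrow> q \<le> m \<Longrightarrow> q = m" by blast
  show thesis
  proof (rule that[of m])
    show "sublinear m" "\<And>x. m x \<le> p x" using m by (auto simp: A_def)
    fix q assume "sublinear q" "\<And>x. q x \<le> m x"
    then show "q = m" using m by (intro min) (auto simp: A_def le_fun_def intro: order_trans)
  qed
qed

text \<open>
  A minimal sublinear functional cannot be lowered by a tilt, in whatever direction, so it is odd,
  hence additive and linear. Tilting \<open>p\<close> once in the direction \<open>v\<close> before
  minimising forces the linear functional to touch \<open>p\<close> at \<open>v\<close>. No extension from
  a subspace is involved, so everything stays on a whole type.
\<close>

theorem Hahn_Banach_sublinear:
  fixes p :: "'a::real_vector \<Rightarrow> real"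
  assumes p: "sublinear p"
  obtains F where "linear F" "\<And>x. F x \<le> p x" "F v = p v"
proof -
  obtain q where q: "sublinear q" "\<And>x. q x \<le> p x" "q (- v) \<le> - p v"
    using sublinear_tilt[OF p] by blast
  obtain m where m: "sublinear m" "\<And>x. m x \<le> q x"
    and min: "\<And>r. sublinear r \<Longrightarrow> (\<And>x. r x \<le> m x) \<Longrightarrow> r = m"
    using minimal_sublinear_exists[OF q(1)] by blast
  \<comment> \<open>By minimality, \<open>m\<close> is equal to its own tilt in the direction \<open>x\<close>.\<close>
  have minus: "m (- x) = - m x" for x
  proof -
    obtain r where "sublinear r" "\<And>y. r y \<le> m y" "r (- x) \<le> - m x"
      using sublinear_tilt[OF m(1)] by blast
    moreover from this have "r = m" by (intro min)
    ultimately show ?thesis using sublinear_minus[OF m(1), of x] by simp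
  qed
  have add: "m (x + y) = m x + m y" for x y
    using sublinear_add[OF m(1), of x y] sublinear_add[OF m(1), of "- x" "- y"]
      minus[of "x + y"] minus[of x] minus[of y] by simp
  have scale: "m (c *\<^sub>R x) = c * m x" for c x
    using sublinear_scaleR[OF m(1), of c x] sublinear_scaleR[OF m(1), of "- c" x]
      minus[of "c *\<^sub>R x"] by (cases "0 \<le> c") auto
  show thesis
  proof (rule that[of m])
    show "linear m" by (rule linearI) (simp_all add: add scale)
    show "m x \<le> p x" for x using m(2)[of x] q(2)[of x] by linarith
    then show "m v = p v" using m(2)[of "- v"] q(3) minus[of v] by (smt (verit))
  qed
qed

corollary Hahn_Banach_blinfun:
  fixes p :: "'a::real_normed_vector \<Rightarrow> real"
  assumes p: "sublinear p" and bound: "\<And>x. p x \<le> C * norm x"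
  obtains f :: "'a \<Rightarrow>\<^sub>L real" where "\<And>x. blinfun_apply f x \<le> p x" "blinfun_apply f v = p v"
proof -
  obtain F where F: "linear F" "\<And>x. F x \<le> p x" "F v = p v"
    using Hahn_Banach_sublinear[OF p] by blast
  have "bounded_linear F"
  proof (rule bounded_linear_intro)
    show "F (x + y) = F x + F y" "F (c *\<^sub>R x) = c *\<^sub>R F x" for x y c
      using F(1) by (simp_all add: linear_add linear_scale)
    show "norm (F x) \<le> norm x * C" for x
      using F(2)[of x] F(2)[of "- x"] bound[of x] bound[of "- x"] linear_neg[OF F(1), of x]
      by (simp add: mult.commute abs_le_iff)
  qed
  then show thesis using F by (intro that[of "Blinfun F"]) (simp_all add: bounded_linear_Blinfun_apply)
qed

lemma norming_functional:
  fixes x :: "'a::real_normed_vector"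
  obtains f :: "'a \<Rightarrow>\<^sub>L real" where "\<And>y. blinfun_apply f y \<le> norm y" "blinfun_apply f x = norm x"
proof -
  have "sublinear (norm :: 'a \<Rightarrow> real)"
    by (rule sublinearI) (auto simp: norm_triangle_ineq)
  from Hahn_Banach_blinfun[OF this, of 1] show thesis using that by auto
qed

text \<open>
  Hahn-Banach for the distance to \<open>Y\<close>, which is sublinear because \<open>Y\<close> is a subspace,
  zero on \<open>Y\<close>, and positive at \<open>v\<close> because \<open>Y\<close> is closed.
\<close>

lemma separating_functional:
  fixes Y :: "'a::real_normed_vector set"
  assumes Y: "subspace Y" "closed Y" and v: "v \<notin> Y"
  shows "\<exists>f :: 'a \<Rightarrow>\<^sub>L real. (\<forall>y\<in>Y. blinfun_apply f y = 0) \<and> blinfun_apply f v \<noteq> 0"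
proof -
  let ?q = "\<lambda>x. INF y\<in>Y. norm (x - y)"
  have ne: "Y \<noteq> {}" and zY: "0 \<in> Y" using subspace_0[OF Y(1)] by auto
  have bdd: "bdd_below ((\<lambda>y. norm (x - y)) ` Y)" for x
    by (rule bdd_belowI2[of _ 0]) simp
  have low: "?q x \<le> norm (x - y)" if "y \<in> Y" for x y
    by (rule cINF_lower[OF bdd that])
  have nonneg: "0 \<le> ?q x" for x
    by (rule cINF_greatest[OF ne]) simp
  have on_Y: "?q y = 0" if "y \<in> Y" for y
    using low[OF that, of y] nonneg[of y] by simp
  have "sublinear ?q"
  proof (rule sublinear_INF[OF ne bdd])
    show "?q 0 = 0" by (rule on_Y[OF zY])
    fix i j x y :: 'a
    assume ij: "i \<in> Y" "j \<in> Y"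
    show "\<exists>k\<in>Y. norm (x + y - k) \<le> norm (x - i) + norm (y - j)"
      using ij subspace_add[OF Y(1)] norm_triangle_ineq[of "x - i" "y - j"]
      by (intro bexI[of _ "i + j"]) (simp_all add: algebra_simps)
    fix c :: real assume "0 < c"
    then have "norm (c *\<^sub>R x - c *\<^sub>R i) = c * norm (x - i)"
      by (simp flip: scaleR_diff_right)
    then show "\<exists>k\<in>Y. norm (c *\<^sub>R x - k) \<le> c * norm (x - i)"
      using ij subspace_scale[OF Y(1)] by (intro bexI[of _ "c *\<^sub>R i"]) simp_all
  qed
  moreover have "?q x \<le> 1 * norm x" for x using low[OF zY, of x] by simp
  ultimately obtain f :: "'a \<Rightarrow>\<^sub>L real" where
    f: "\<And>x. blinfun_apply f x \<le> ?q x" "blinfun_apply f v = ?q v"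
    using Hahn_Banach_blinfun[of ?q 1] by blast
  obtain e where e: "0 < e" "ball v e \<subseteq> - Y"
    using Y(2) v by (metis ComplI openE open_Compl)
  have "e \<le> ?q v"
    using e(2) by (intro cINF_greatest[OF ne]) (force simp: dist_norm not_le)
  moreover have "blinfun_apply f y = 0" if "y \<in> Y" for y
    using f(1)[of y] f(1)[of "- y"] on_Y[OF that] on_Y[OF subspace_neg[OF Y(1) that]]
    by (simp add: blinfun.minus_right)
  ultimately show ?thesis using f(2) e(1) by (intro exI[of _ f]) auto
qed

section \<open>Weak sequential compactness in reflexive spaces\<close>

lemma limitin_weak_topologyI:
  fixes s :: "'i \<Rightarrow> 'a::real_normed_vector"
  assumes "\<And>f :: 'a \<Rightarrow>\<^sub>L real. ((\<lambda>n. blinfun_apply f (s n)) \<longlongrightarrow> blinfun_apply f u) F"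
  shows "limitin weak_topology s u F"
  unfolding limitin_def
proof (intro conjI allI impI)
  let ?S = "{blinfun_apply f -` U | (f :: 'a \<Rightarrow>\<^sub>L real) U. open U}"
  have "UNIV \<in> ?S" by (force intro: exI[of _ UNIV])
  then show "u \<in> topspace weak_topology" by (auto simp: weak_topology_def)
  fix W assume W: "openin weak_topology W \<and> u \<in> W"
  then have "generate_topology_on ?S W"
    by (simp add: weak_topology_def openin_topology_generated_by_iff)
  then have "u \<in> W \<longrightarrow> (\<forall>\<^sub>F n in F. s n \<in> W)"
  proof induct
    case (UN \<K>)
    show ?case
    proof
      assume "u \<in> \<Union>\<K>"
      then obtain V where V: "V \<in> \<K>" "u \<in> V" by blast
      then have "\<forall>\<^sub>F n in F. s n \<in> V" using UN(2) by blast
      then show "\<forall>\<^sub>F n in F. s n \<in> \<Union>\<K>" by eventually_elim (use V in blast)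
    qed
  next
    case (Basis W)
    then obtain f :: "'a \<Rightarrow>\<^sub>L real" and U where U: "open U" "W = blinfun_apply f -` U" by blast
    then show ?case using topological_tendstoD[OF assms U(1), of f] by simp
  qed (auto intro: eventually_conj)
  then show "\<forall>\<^sub>F n in F. s n \<in> W" using W by blast
qed

text \<open>
  The upper limit \<open>f \<mapsto> limsup f (z n)\<close> is a sublinear functional on the dual. A linear
  functional below it is bounded, so by reflexivity it is evaluation at a point \<open>x\<close>, and this
  point behaves like a weak cluster point of the sequence: no functional is larger at \<open>x\<close>
  than it eventually is along the sequence. Touching the upper limit at one prescribed \<open>g\<close>
  selects a cluster point that witnesses the large values of \<open>g\<close>. This takes the place of weak
  compactness of the ball.
\<close>

lemma reflexive_weak_cluster_point:
  fixes z :: "nat \<Rightarrow> 'a::real_normed_vector" and g :: "'a \<Rightarrow>\<^sub>L real"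
  assumes refl: "reflexive_space TYPE('a)" and B: "\<And>n. norm (z n) \<le> B"
    and freq: "\<exists>\<^sub>F n in sequentially. a \<le> blinfun_apply g (z n)"
  shows "\<exists>x. a \<le> blinfun_apply g x \<and> (\<forall>(f :: 'a \<Rightarrow>\<^sub>L real) c.
    (\<forall>\<^sub>F n in sequentially. blinfun_apply f (z n) \<le> c) \<longrightarrow> blinfun_apply f x \<le> c)"
proof -
  let ?g = "\<lambda>N (f :: 'a \<Rightarrow>\<^sub>L real). SUP n\<in>{N..}. blinfun_apply f (z n)"
  let ?p = "\<lambda>f. INF N. ?g N f"
  have bound: "\<bar>blinfun_apply f (z n)\<bar> \<le> B * norm f" for f n
    using norm_blinfun[of f "z n"] mult_left_mono[OF B[of n] norm_ge_zero[of f]]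
    by (simp add: mult.commute)
  have bdd_above: "bdd_above ((\<lambda>n. blinfun_apply f (z n)) ` {N..})" for f :: "'a \<Rightarrow>\<^sub>L real" and N
  proof (rule bdd_aboveI2)
    show "blinfun_apply f (z n) \<le> B * norm f" for n using bound[of f n] by linarith
  qed
  have up: "blinfun_apply f (z n) \<le> ?g N f" if "N \<le> n" for f n N
    using that by (intro cSUP_upper[OF _ bdd_above]) simp
  have bdd: "bdd_below (range (\<lambda>N. ?g N f))" for f
  proof (rule bdd_belowI2)
    fix N show "- (B * norm f) \<le> ?g N f"
      using bound[of f N] up[of N N f] by (simp add: abs_le_iff)
  qed
  have low: "?p f \<le> ?g N f" for f N by (intro cINF_lower[OF bdd]) simp
  have sub: "sublinear ?p"
  proof (rule sublinear_INF[OF _ bdd])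
    fix i j x y
    show "\<exists>k\<in>UNIV. ?g k (x + y) \<le> ?g i x + ?g j y"
    proof (intro bexI[of _ "max i j"] cSUP_least)
      fix n assume "n \<in> {max i j..}"
      then show "blinfun_apply (x + y) (z n) \<le> ?g i x + ?g j y"
        using up[of i n x] up[of j n y] by (simp add: blinfun.add_left)
    qed auto
    fix c :: real assume c: "0 < c"
    show "\<exists>k\<in>UNIV. ?g k (c *\<^sub>R x) \<le> c * ?g i x"
    proof (intro bexI[of _ i] cSUP_least)
      fix n assume "n \<in> {i..}"
      then show "blinfun_apply (c *\<^sub>R x) (z n) \<le> c * ?g i x"
        using up[of i n x] c by (simp add: blinfun.scaleR_left)
    qed auto
  qed auto
  have ev: "?p f \<le> c" if ev: "\<forall>\<^sub>F n in sequentially. blinfun_apply f (z n) \<le> c" for f c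
  proof -
    obtain N where "\<And>n. N \<le> n \<Longrightarrow> blinfun_apply f (z n) \<le> c"
      using ev by (auto simp: eventually_sequentially)
    then have "?g N f \<le> c" by (intro cSUP_least) auto
    then show ?thesis using low[of f N] by linarith
  qed
  have "?p f \<le> B * norm f" for f
    by (rule ev) (use bound in \<open>auto simp: abs_le_iff\<close>)
  then obtain F :: "('a \<Rightarrow>\<^sub>L real) \<Rightarrow>\<^sub>L real" where
    F: "\<And>f. blinfun_apply F f \<le> ?p f" "blinfun_apply F g = ?p g"
    using Hahn_Banach_blinfun[OF sub] by blast
  obtain x where x: "\<And>f. blinfun_apply F f = blinfun_apply f x"
    using refl unfolding reflexive_space_def by blast
  have "a \<le> ?p g"
  proof (rule cINF_greatest)
    fix N
    obtain n where "N \<le> n" "a \<le> blinfun_apply g (z n)"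
      using freq by (auto simp: frequently_sequentially)
    then show "a \<le> ?g N g" using up[of N n g] by linarith
  qed simp
  show ?thesis
  proof (intro exI[of _ x] conjI allI impI)
    show "a \<le> blinfun_apply g x" using F(2) \<open>a \<le> ?p g\<close> by (simp add: x)
    fix f :: "'a \<Rightarrow>\<^sub>L real" and c
    assume "\<forall>\<^sub>F n in sequentially. blinfun_apply f (z n) \<le> c"
    then show "blinfun_apply f x \<le> c" using F(1)[of f] ev[of f c] by (simp add: x)
qed
qed

text \<open>
  Rational linear combinations, indexed by lists of coefficient-index pairs so that countability is
  immediate.
\<close>

lemma countable_dense_in_span:
  fixes z :: "nat \<Rightarrow> 'a::real_normed_vector"
  obtains q :: "nat \<Rightarrow> 'a" where "closure (span (range z)) \<subseteq> closure (range q)"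
proof -
  define comb where "comb l = (\<Sum>(c, i)\<leftarrow>l. of_rat c *\<^sub>R z i)" for l :: "(rat \<times> nat) list"
  have "x \<in> closure (range comb)" if "x \<in> span (range z)" for x
    using that
  proof (induct rule: span_induct_alt)
    case base
    have "comb [] = 0" by (simp add: comb_def)
    then show ?case by (metis closure_subset rangeI subsetD)
  next
    case (step c x y)
    obtain i where i: "x = z i" using step(1) by auto
    show ?case
    proof (subst closure_approachable, intro allI impI)
      fix e :: real assume e: "0 < e"
      obtain l where l: "dist (comb l) y < e / 2"
        using step(2) e by (auto simp: closure_approachable dest!: spec[of _ "e / 2"])
      have d: "0 < e / (2 * (norm x + 1))" using e by (simp add: add_nonneg_pos)
      then obtain r where r: "of_rat r \<in> {c<..<c + e / (2 * (norm x + 1))}"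
        using of_rat_dense[of c "c + e / (2 * (norm x + 1))"] by auto
      have "\<bar>of_rat r - c\<bar> * norm x \<le> e / (2 * (norm x + 1)) * norm x"
        using r by (intro mult_right_mono) auto
      also have "\<dots> \<le> e / 2"
      proof -
        have "e * norm x \<le> e * (norm x + 1)" using e by simp
        moreover have "0 < norm x + 1" by (simp add: add_nonneg_pos)
        ultimately show ?thesis by (simp add: field_simps)
      qed
      finally have "norm ((of_rat r - c) *\<^sub>R x) \<le> e / 2" by simp
      moreover have split: "comb ((r, i) # l) - (c *\<^sub>R x + y) = (of_rat r - c) *\<^sub>R x + (comb l - y)"
        by (simp add: comb_def i scaleR_left_diff_distrib)
      ultimately have "dist (comb ((r, i) # l)) (c *\<^sub>R x + y) < e"
        using l norm_triangle_ineq[of "(of_rat r - c) *\<^sub>R x" "comb l - y"]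
        unfolding dist_norm split by linarith
      then show "\<exists>w\<in>range comb. dist w (c *\<^sub>R x + y) < e" by blast
    qed
  qed
  then have "closure (span (range z)) \<subseteq> closure (range comb)"
    by (intro closure_minimal) auto
  moreover have "range comb = range (comb \<circ> from_nat)"
    by (metis fun.set_map surj_from_nat)
  ultimately show thesis using that by metis
qed

text \<open>
  Functionals that norm a countable dense set suffice: a point that they all annihilate is close to
  some \<open>q k\<close>, while \<open>g k\<close> still sees the full norm of \<open>q k\<close>.
\<close>

lemma countable_separating_functionals:
  fixes z :: "nat \<Rightarrow> 'a::real_normed_vector"
  shows "\<exists>g :: nat \<Rightarrow> 'a \<Rightarrow>\<^sub>L real.
    \<forall>x\<in>closure (span (range z)). (\<forall>k. blinfun_apply (g k) x = 0) \<longrightarrow> x = 0"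
proof -
  obtain q :: "nat \<Rightarrow> 'a" where q: "closure (span (range z)) \<subseteq> closure (range q)"
    using countable_dense_in_span by blast
  have "\<forall>k. \<exists>f :: 'a \<Rightarrow>\<^sub>L real. (\<forall>y. blinfun_apply f y \<le> norm y) \<and> blinfun_apply f (q k) = norm (q k)"
    using norming_functional by metis
  then obtain g :: "nat \<Rightarrow> 'a \<Rightarrow>\<^sub>L real" where
    g: "\<And>k y. blinfun_apply (g k) y \<le> norm y" "\<And>k. blinfun_apply (g k) (q k) = norm (q k)"
    by metis
  show ?thesis
  proof (intro exI[of _ g] ballI impI, rule ccontr)
    fix x assume x: "x \<in> closure (span (range z))" "\<forall>k. blinfun_apply (g k) x = 0" "x \<noteq> 0"
    then have "x \<in> closure (range q)" "0 < norm x / 2" using q by auto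
    then obtain k where k: "norm (q k - x) < norm x / 2"
      by (auto simp only: closure_approachable dist_norm)
    have "norm (q k) = blinfun_apply (g k) (q k - x)"
      by (simp add: blinfun.diff_right g(2) x(2))
    then have "norm (q k) \<le> norm (q k - x)" using g(1) by metis
    then show False using k norm_triangle_ineq2[of x "q k"] by (simp add: norm_minus_commute)
  qed
qed

text \<open>
  The product of the compact intervals is compact by Tychonoff's theorem and, since there are countably
  many factors, metrizable; so the diagonal argument is sequential compactness of the product.
\<close>

lemma diagonal_subsequence:
  fixes a :: "nat \<Rightarrow> nat \<Rightarrow> real"
  assumes "\<And>k n. \<bar>a n k\<bar> \<le> C k"
  shows "\<exists>r L. strict_mono r \<and> (\<forall>k. (\<lambda>n. a (r n) k) \<longlonglongrightarrow> L k)"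
proof -
  let ?S = "PiE UNIV (\<lambda>k. {- C k..C k})"
  have "compact ?S"
    using compactin_PiE[of "\<lambda>_. euclidean" UNIV "\<lambda>k. {- C k..C k}"]
    by (simp add: euclidean_product_topology)
  then have "seq_compact ?S" by (simp add: compact_eq_seq_compact_metric)
  moreover have "a n \<in> ?S" for n using assms by (auto simp: abs_le_iff minus_le_iff)
  ultimately obtain L r where r: "strict_mono r" and lim: "(a \<circ> r) \<longlonglongrightarrow> L"
    unfolding seq_compact_def by metis
  have "(\<lambda>n. a (r n) k) \<longlonglongrightarrow> L k" for k
    using continuous_on_tendsto_compose[OF continuous_on_product_coordinates[of k] lim] by simp
  then show ?thesis using r by blast
qed

lemma subspace_closure:
  fixes S :: "'a::real_normed_vector set"
  assumes S: "subspace S"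
  shows "subspace (closure S)"
  unfolding subspace_def
proof (intro conjI ballI allI)
  show "0 \<in> closure S" using subspace_0[OF S] closure_subset by blast
  fix x y assume "x \<in> closure S" "y \<in> closure S"
  then obtain a b where a: "\<And>n. a n \<in> S" "a \<longlonglongrightarrow> x" and b: "\<And>n. b n \<in> S" "b \<longlonglongrightarrow> y"
    by (auto simp: closure_sequential)
  show "x + y \<in> closure S"
    unfolding closure_sequential using tendsto_add[OF a(2) b(2)] subspace_add[OF S a(1) b(1)]
    by (intro exI[of _ "\<lambda>n. a n + b n"]) simp
next
  fix c :: real and x assume "x \<in> closure S"
  then obtain a where a: "\<And>n. a n \<in> S" "a \<longlonglongrightarrow> x" by (auto simp: closure_sequential)
  show "c *\<^sub>R x \<in> closure S"
    unfolding closure_sequential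
    using tendsto_scaleR[OF tendsto_const a(2)] subspace_scale[OF S a(1)]
    by (intro exI[of _ "\<lambda>n. c *\<^sub>R a n"]) simp
qed

text \<open>
  Choose a subsequence along which countably many functionals converge that separate the points of
  the closed span \<open>Y\<close> of the sequence. Every cluster point lies in \<open>Y\<close>, since
  functionals vanishing on \<open>Y\<close> vanish at it, and its values under the countably many
  functionals are prescribed. So there is just one cluster point \<open>u\<close>, and a sequence that
  failed to converge weakly to \<open>u\<close> would have another one, by the preceding choice of a cluster
  point at which a given functional is large. Working with functionals on the whole space avoids the
  reflexivity of \<open>Y\<close> and the separability of its dual.
\<close>

theorem reflexive_bounded_weakly_convergent_subsequence:
  fixes z :: "nat \<Rightarrow> 'a::real_normed_vector"
  assumes refl: "reflexive_space TYPE('a)" and B: "\<And>n. norm (z n) \<le> B"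
  shows "\<exists>r u. strict_mono r \<and> limitin weak_topology (z \<circ> r) u sequentially"
proof -
  let ?Y = "closure (span (range z))"
  have Y: "subspace ?Y" by (rule subspace_closure[OF subspace_span])
  obtain g :: "nat \<Rightarrow> 'a \<Rightarrow>\<^sub>L real"
    where g: "\<forall>x\<in>?Y. (\<forall>k. blinfun_apply (g k) x = 0) \<longrightarrow> x = 0"
    using countable_separating_functionals[of z] by (elim exE)
  have sep: "x = 0" if "x \<in> ?Y" "\<And>k. blinfun_apply (g k) x = 0" for x
    using g that by simp
  have "\<bar>blinfun_apply (g k) (z n)\<bar> \<le> norm (g k) * B" for k n
    using order_trans[OF norm_blinfun mult_left_mono[OF B[of n] norm_ge_zero[of "g k"]]] by simp
  then have "\<exists>r L. strict_mono r \<and> (\<forall>k. (\<lambda>n. blinfun_apply (g k) (z (r n))) \<longlonglongrightarrow> L k)"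
    by (rule diagonal_subsequence)
  then obtain r L where r: "strict_mono r"
    and L: "\<forall>k. (\<lambda>n. blinfun_apply (g k) (z (r n))) \<longlonglongrightarrow> L k"
    by blast
  let ?w = "z \<circ> r"
  \<comment> \<open>The defining property of the points supplied by \<open>reflexive_weak_cluster_point\<close>.\<close>
  define cluster where "cluster x \<longleftrightarrow>
    (\<forall>(f :: 'a \<Rightarrow>\<^sub>L real) c. (\<forall>\<^sub>F n in sequentially. blinfun_apply f (?w n) \<le> c) \<longrightarrow> blinfun_apply f x \<le> c)" for x
  have cluster_le: "blinfun_apply f x \<le> c"
    if "cluster x" "\<forall>\<^sub>F n in sequentially. blinfun_apply f (?w n) \<le> c"
    for f :: "'a \<Rightarrow>\<^sub>L real" and x c
    using that by (simp add: cluster_def)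
  have limit: "blinfun_apply f x = l"
    if x: "cluster x" and l: "(\<lambda>n. blinfun_apply f (?w n)) \<longlonglongrightarrow> l" for f :: "'a \<Rightarrow>\<^sub>L real" and x l
  proof -
    have "blinfun_apply f x \<le> l + e \<and> l \<le> blinfun_apply f x + e" if e: "0 < e" for e
    proof -
      have near: "\<forall>\<^sub>F n in sequentially. dist (blinfun_apply f (?w n)) l < e"
        by (rule tendstoD[OF l e])
      then have "\<forall>\<^sub>F n in sequentially. blinfun_apply f (?w n) \<le> l + e"
        by eventually_elim (simp add: dist_real_def abs_less_iff)
      then have "blinfun_apply f x \<le> l + e"
        by (rule cluster_le[OF x])
      moreover from near have "\<forall>\<^sub>F n in sequentially. blinfun_apply (- f) (?w n) \<le> - l + e"
        by eventually_elim (simp add: dist_real_def abs_less_iff blinfun.minus_left)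
      then have "blinfun_apply (- f) x \<le> - l + e"
        by (rule cluster_le[OF x])
      ultimately show ?thesis by (simp add: blinfun.minus_left)
    qed
    then show ?thesis by (meson antisym field_le_epsilon)
  qed
  have in_Y: "x \<in> ?Y" if x: "cluster x" for x
  proof (rule ccontr)
    assume "x \<notin> ?Y"
    then obtain f :: "'a \<Rightarrow>\<^sub>L real"
      where f: "\<forall>y\<in>?Y. blinfun_apply f y = 0" "blinfun_apply f x \<noteq> 0"
      using separating_functional[OF Y closed_closure, of x] by blast
    have "?w n \<in> ?Y" for n
      using span_base[of "z (r n)" "range z"] closure_subset by auto
    then have "(\<lambda>n. blinfun_apply f (?w n)) \<longlonglongrightarrow> 0" using f(1) by simp
    from limit[OF x this] f(2) show False by simp
  qed
  have unique: "x = y" if xy: "cluster x" "cluster y" for x y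
  proof -
    have "x - y \<in> ?Y" using in_Y[OF xy(1)] in_Y[OF xy(2)]
      by (intro subspace_diff[OF Y])
    moreover have "blinfun_apply (g k) (x - y) = 0" for k
      using limit[OF xy(1), of "g k" "L k"] limit[OF xy(2), of "g k" "L k"] L
      by (simp add: blinfun.diff_right)
    ultimately have "x - y = 0" by (rule sep)
    then show ?thesis by simp
  qed
  have exists: "\<exists>x. a \<le> blinfun_apply f x \<and> cluster x"
    if "\<exists>\<^sub>F n in sequentially. a \<le> blinfun_apply f (?w n)" for f :: "'a \<Rightarrow>\<^sub>L real" and a
    unfolding cluster_def by (rule reflexive_weak_cluster_point[OF refl _ that, of B]) (simp add: B)
  \<comment> \<open>The zero functional imposes nothing, so it provides some cluster point.\<close>
  have "\<exists>\<^sub>F n in sequentially. 0 \<le> blinfun_apply (0 :: 'a \<Rightarrow>\<^sub>L real) (?w n)" by (simp add: frequently_const)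
  from exists[OF this] obtain u where u: "cluster u" by auto
  \<comment> \<open>Otherwise there is a cluster point where \<open>f\<close> is larger than at \<open>u\<close>.\<close>
  have upper: "\<forall>\<^sub>F n in sequentially. blinfun_apply f (?w n) < blinfun_apply f u + e"
    if e: "0 < e" for f :: "'a \<Rightarrow>\<^sub>L real" and e
  proof (rule ccontr)
    assume "\<not> ?thesis"
    then obtain x where "cluster x" "blinfun_apply f u + e \<le> blinfun_apply f x"
      using exists[of "blinfun_apply f u + e" f] unfolding not_eventually not_less by auto
    then show False using unique[OF u] e by auto
  qed
  have "(\<lambda>n. blinfun_apply f (?w n)) \<longlonglongrightarrow> blinfun_apply f u" for f :: "'a \<Rightarrow>\<^sub>L real"
  proof (rule tendstoI)
    fix e :: real assume e: "0 < e"
    show "\<forall>\<^sub>F n in sequentially. dist (blinfun_apply f (?w n)) (blinfun_apply f u) < e"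
      using upper[OF e, of f] upper[OF e, of "- f"]
      by eventually_elim (simp add: blinfun.minus_left dist_real_def abs_less_iff)
  qed
  then have "limitin weak_topology ?w u sequentially" by (rule limitin_weak_topologyI)
  then show ?thesis using r by blast
qed

section \<open>Complete continuity of the solution operator\<close>

text \<open>
  Both estimates come from pairing a difference of states with the difference of their images under
  \<open>N\<close>. Comparing \<open>T (s n)\<close> with \<open>H (s n)\<close> bounds \<open>K (N (T (s n)))\<close> in
  terms of \<open>N (H (s n))\<close>, hence the states, hence, as \<open>N\<close> is a bounded operator, their
  images. With this bound \<open>M\<close> available, comparing \<open>T (s n)\<close> with \<open>T u\<close> gives
  \<open>d \<parallel>K (N (T (s n)) - N (T u))\<parallel>\<^sup>2 \<le> (M + \<parallel>N (T u)\<parallel>) \<parallel>H (s n) - H u\<parallel>\<close>.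
\<close>

lemma completely_continuous_solution_of_monotone_equation:
  fixes K :: "('x::real_normed_vector \<Rightarrow>\<^sub>L real) \<Rightarrow> 'x"
    and H :: "'z::real_normed_vector \<Rightarrow> 'x"
  assumes K: "linear K" and d: "0 < d" "\<And>f. d * (norm (K f))\<^sup>2 \<le> blinfun_apply f (K f)"
    and N: "bounded_operator N" "negatively_monotone N"
    and H: "completely_continuous H"
    and T: "\<And>u. T u = K (N (T u)) + H u"
  shows "completely_continuous T"
  unfolding completely_continuous_def
proof (intro allI impI)
  fix s :: "nat \<Rightarrow> 'z" and u assume "limitin weak_topology s u sequentially"
  then have lim: "(\<lambda>n. H (s n)) \<longlonglongrightarrow> H u" using H by (simp add: completely_continuous_def)
  have mono: "blinfun_apply (N x - N y) (x - y) \<le> 0" for x y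
    using N(2) by (simp add: negatively_monotone_def)
  have bounded_H: "bounded (range (\<lambda>n. H (s n)))"
    by (rule convergent_imp_bounded[OF lim])
  have "bounded (N ` range (\<lambda>n. H (s n)))"
    using N(1) bounded_H by (simp add: bounded_operator_def)
  then obtain C where C: "\<And>n. norm (N (H (s n))) \<le> C"
    unfolding bounded_iff by auto
  \<comment> \<open>Monotonicity between \<open>T (s n)\<close> and \<open>H (s n)\<close>, whose difference is \<open>K (N (T (s n)))\<close>.\<close>
  have K_bound: "norm (K (N (T (s n)))) \<le> C / d" for n
  proof -
    let ?x = "T (s n)" and ?h = "H (s n)"
    have x: "?x - ?h = K (N ?x)" using T[of "s n"] by (metis add_diff_cancel_right')
    have "d * (norm (K (N ?x)))\<^sup>2 \<le> blinfun_apply (N ?x) (?x - ?h)"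
      using d(2) x by metis
    also have "\<dots> \<le> blinfun_apply (N ?h) (?x - ?h)"
      using mono[of ?x ?h] by (simp add: blinfun.diff_left)
    also have "\<dots> \<le> C * norm (K (N ?x))"
      using norm_blinfun[of "N ?h" "K (N ?x)"] mult_right_mono[OF C[of n] norm_ge_zero[of "K (N ?x)"]]
      unfolding x real_norm_def by linarith
    finally have "d * norm (K (N ?x)) * norm (K (N ?x)) \<le> C * norm (K (N ?x))"
      by (simp add: power2_eq_square mult.assoc)
    moreover have "0 \<le> C" using C[of n] norm_ge_zero order_trans by blast
    ultimately have "d * norm (K (N ?x)) \<le> C"
      by (cases "norm (K (N ?x)) = 0") (auto simp: mult_le_cancel_right)
    then show ?thesis using d(1) by (simp add: field_simps)
  qed
  obtain D where "\<And>n. norm (H (s n)) \<le> D" using bounded_H unfolding bounded_iff by auto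
  then have "norm (T (s n)) \<le> C / d + D" for n
    using K_bound[of n] T[of "s n"] by (metis norm_triangle_mono)
  then have "bounded (range (\<lambda>n. T (s n)))" unfolding bounded_iff by auto
  then have "bounded (N ` range (\<lambda>n. T (s n)))"
    using N(1) by (simp add: bounded_operator_def)
  then obtain M where M: "\<And>n. norm (N (T (s n))) \<le> M"
    unfolding bounded_iff by auto
  let ?g = "\<lambda>n. N (T (s n)) - N (T u)"
  let ?R = "\<lambda>n. (M + norm (N (T u))) * norm (H (s n) - H u)"
  have diff: "T (s n) - T u = K (?g n) + (H (s n) - H u)" for n
  proof -
    have "T (s n) - T u = (K (N (T (s n))) + H (s n)) - (K (N (T u)) + H u)" using T by metis
    then show ?thesis by (simp add: linear_diff[OF K])
  qed
  have "d * (norm (K (?g n)))\<^sup>2 \<le> ?R n" for n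
  proof -
    have "d * (norm (K (?g n)))\<^sup>2 \<le> blinfun_apply (?g n) (K (?g n))" by (rule d(2))
    also have "\<dots> \<le> - blinfun_apply (?g n) (H (s n) - H u)"
      using mono[of "T (s n)" "T u"] unfolding diff by (simp add: blinfun.add_right)
    also have "\<dots> \<le> norm (?g n) * norm (H (s n) - H u)"
      using norm_blinfun[of "?g n" "H (s n) - H u"] unfolding real_norm_def by linarith
    also have "\<dots> \<le> ?R n"
      using norm_triangle_ineq4[of "N (T (s n))" "N (T u)"] M[of n]
      by (intro mult_right_mono) auto
    finally show ?thesis .
  qed
  then have bound: "norm (K (?g n)) \<le> sqrt (?R n / d)" for n
    using d(1) by (intro real_le_rsqrt) (simp add: field_simps)
  have H0: "(\<lambda>n. H (s n) - H u) \<longlonglongrightarrow> 0" using lim by (simp add: LIM_zero)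
  then have "(\<lambda>n. sqrt (?R n / d)) \<longlonglongrightarrow> sqrt ((M + norm (N (T u))) * norm (0::'x) / d)"
    using d(1) by (intro tendsto_intros) auto
  then have "(\<lambda>n. sqrt (?R n / d)) \<longlonglongrightarrow> 0" by simp
  then have "(\<lambda>n. K (?g n)) \<longlonglongrightarrow> 0"
    by (rule Lim_null_comparison[rotated]) (simp add: bound)
  then have "(\<lambda>n. T (s n) - T u) \<longlonglongrightarrow> 0"
    unfolding diff using H0 tendsto_add by fastforce
  then show "(\<lambda>n. T (s n)) \<longlonglongrightarrow> T u" by (rule LIM_zero_cancel)
qed

context
  fixes ip :: "'x::real_normed_vector \<Rightarrow> 'x \<Rightarrow> real"
  assumes ip: "inner_product_for_norm ip"
begin

lemma ip_commute: "ip x y = ip y x"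
  and ip_add_left: "ip (x + y) z = ip x z + ip y z"
  and ip_scaleR_left: "ip (r *\<^sub>R x) y = r * ip x y"
  and ip_self: "ip x x = (norm x)\<^sup>2"
  using ip unfolding inner_product_for_norm_def by (blast, blast, blast, metis real_sqrt_pow2)

lemma ip_add_right: "ip x (y + z) = ip x y + ip x z"
  and ip_scaleR_right: "ip x (r *\<^sub>R y) = r * ip x y"
  using ip_add_left ip_scaleR_left ip_commute by metis+

lemma ip_minus_left: "ip (- x) y = - ip x y"
  and ip_minus_right: "ip x (- y) = - ip x y"
  using ip_scaleR_left[of "-1"] ip_scaleR_right[of _ "-1"] by simp_all

lemma ip_diff_left: "ip (x - y) z = ip x z - ip y z"
  and ip_diff_right: "ip x (y - z) = ip x y - ip x z"
  using ip_add_left[of x "- y"] ip_add_right[of x y "- z"]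
  by (simp_all add: ip_minus_left ip_minus_right)

lemma ip_Cauchy_Schwarz: "\<bar>ip x y\<bar> \<le> norm x * norm y"
proof (cases "y = 0")
  case True
  then show ?thesis using ip_scaleR_right[of x 0 y] by simp
next
  case False
  then have y: "0 < (norm y)\<^sup>2" by simp
  let ?t = "ip x y / (norm y)\<^sup>2"
  have "0 \<le> ip (x - ?t *\<^sub>R y) (x - ?t *\<^sub>R y)" unfolding ip_self by simp
  also have "\<dots> = ip x x - ?t * ip x y - ?t * (ip y x - ?t * ip y y)"
    unfolding ip_diff_left ip_diff_right ip_scaleR_left ip_scaleR_right by (simp add: algebra_simps)
  also have "\<dots> = (norm x)\<^sup>2 - (ip x y)\<^sup>2 / (norm y)\<^sup>2"
    using y unfolding ip_self ip_commute[of y x] by (simp add: power2_eq_square)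
  finally have "(ip x y)\<^sup>2 \<le> (norm x * norm y)\<^sup>2"
    using y by (simp add: field_simps power_mult_distrib)
  then show ?thesis by (simp add: power2_le_iff_abs_le)
qed

lemma riesz_map_apply: "blinfun_apply (riesz_map ip x) y = ip x y"
proof -
  have "bounded_linear (ip x)"
    using ip_Cauchy_Schwarz[of x]
    by (intro bounded_linear_intro[of _ "norm x"]) (auto simp: ip_add_right ip_scaleR_right mult.commute)
  then show ?thesis by (simp add: riesz_map_def bounded_linear_Blinfun_apply)
qed

lemma linear_riesz_map: "linear (riesz_map ip)"
  by (rule linearI; rule blinfun_eqI)
    (simp_all add: riesz_map_apply blinfun.add_left blinfun.scaleR_left ip_add_left ip_scaleR_left)

lemma norm_le_norm_riesz_map: "norm x \<le> norm (riesz_map ip x)"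
proof (cases "x = 0")
  case False
  have "norm x * norm x \<le> norm (riesz_map ip x) * norm x"
    using norm_blinfun[of "riesz_map ip x" x] by (simp add: riesz_map_apply ip_self power2_eq_square)
  then show ?thesis using False by simp
qed simp

end

text \<open>
  The range of the Riesz map is closed, because the map does not shrink norms. If it were not the whole
  dual, some nonzero element of the bidual would vanish on it; by reflexivity that element is a vector
  \<open>x\<close>, and \<open>ip x x = 0\<close> makes it zero.
\<close>

lemma riesz_map_surj:
  fixes ip :: "'x::banach \<Rightarrow> 'x \<Rightarrow> real"
  assumes ip: "inner_product_for_norm ip" and refl: "reflexive_space TYPE('x)"
  shows "surj (riesz_map ip)"
proof (rule ccontr)
  let ?R = "riesz_map ip"
  interpret R: linear ?R by (rule linear_riesz_map[OF ip])
  have "bounded_linear ?R"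
  proof (rule bounded_linear_intro)
    show "norm (?R x) \<le> norm x * 1" for x
      using ip_Cauchy_Schwarz[OF ip, of x]
      by (intro norm_blinfun_bound) (auto simp: riesz_map_apply[OF ip])
  qed (simp_all add: R.add R.scale)
  then have "complete (range ?R)"
    using norm_le_norm_riesz_map[OF ip] complete_UNIV
    by (intro complete_isometric_image[of 1]) auto
  then have closed: "closed (range ?R)" by (rule complete_imp_closed)
  have subspace: "subspace (range ?R)" by (rule linear_subspace_image[OF linear_riesz_map[OF ip] subspace_UNIV])
  assume "range ?R \<noteq> UNIV"
  then obtain g where g: "g \<notin> range ?R" by blast
  obtain F :: "('x \<Rightarrow>\<^sub>L real) \<Rightarrow>\<^sub>L real"
    where F: "\<forall>y\<in>range ?R. blinfun_apply F y = 0" "blinfun_apply F g \<noteq> 0"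
    using separating_functional[OF subspace closed g] by blast
  obtain x where x: "\<And>f. blinfun_apply F f = blinfun_apply f x"
    using refl unfolding reflexive_space_def by blast
  have "blinfun_apply (?R x) x = 0" using F(1) x[of "?R x"] by simp
  then have "x = 0" by (simp add: riesz_map_apply[OF ip] ip_self[OF ip])
  then show False using F(2) by (simp add: x)
qed

lemma mu_positive_imp_strongly_monotone:
  assumes ip: "inner_product_for_norm ip" and "0 < mu ip P"
  obtains m where "0 < m" "\<And>x y. m * (norm (x - y))\<^sup>2 \<le> ip (P x - P y) (x - y)"
proof -
  obtain m where m: "0 < ereal m" "ereal m < mu ip P"
    using ereal_dense2[OF assms(2)] by blast
  show thesis
  proof (rule that[of m])
    show "0 < m" using m(1) by simp
    fix x y
    show "m * (norm (x - y))\<^sup>2 \<le> ip (P x - P y) (x - y)"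
    proof (cases "x = y")
      case False
      then have "mu ip P \<le> ereal (ip (P x - P y) (x - y) / (norm (x - y))\<^sup>2)"
        unfolding mu_def by (intro Inf_lower CollectI exI[of _ x] exI[of _ y]) simp
      with m(2) have "ereal m < ereal (ip (P x - P y) (x - y) / (norm (x - y))\<^sup>2)"
        by (rule less_le_trans)
      then show ?thesis using False by (simp add: field_simps)
    next
      case True
      then show ?thesis using ip_self[OF ip, of 0] by simp
    qed
  qed
qed

text \<open>
  With \<open>e\<close>, \<open>w\<close> and \<open>h\<close> the differences of the states, of their images under
  \<open>N\<close> and of the data, the equation reads \<open>e = K w + h\<close>, and its inner product with
  \<open>w\<close> yields \<open>c \<parallel>w\<parallel>\<^sup>2 + m \<parallel>e\<parallel>\<^sup>2 \<le> \<parallel>w\<parallel> \<parallel>h\<parallel>\<close>. The first summand bounds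
  \<open>\<parallel>w\<parallel>\<close> by \<open>\<parallel>h\<parallel> / c\<close>, and then the second one bounds \<open>c m \<parallel>e\<parallel>\<^sup>2\<close> by
  \<open>\<parallel>h\<parallel>\<^sup>2\<close>.
\<close>

lemma completely_continuous_solution_of_strongly_monotone_equation:
  fixes ip :: "'x::real_normed_vector \<Rightarrow> 'x \<Rightarrow> real"
    and H :: "'z::real_normed_vector \<Rightarrow> 'x"
  assumes ip: "inner_product_for_norm ip"
    and K: "linear K" "0 < c" "\<And>x. c * (norm x)\<^sup>2 \<le> ip (K x) x"
    and N: "0 < m" "\<And>x y. m * (norm (x - y))\<^sup>2 \<le> - ip (N x - N y) (x - y)"
    and H: "completely_continuous H"
    and T: "\<And>u. T u = K (N (T u)) + H u"
  shows "completely_continuous T"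
  unfolding completely_continuous_def
proof (intro allI impI)
  fix s :: "nat \<Rightarrow> 'z" and u assume "limitin weak_topology s u sequentially"
  then have lim: "(\<lambda>n. H (s n)) \<longlonglongrightarrow> H u" using H by (simp add: completely_continuous_def)
  have bound: "norm (T v - T u) \<le> sqrt ((norm (H v - H u))\<^sup>2 / (c * m))" for v
  proof -
    let ?e = "T v - T u" and ?w = "N (T v) - N (T u)" and ?h = "H v - H u"
    have e: "?e = K ?w + ?h"
    proof -
      have "?e = (K (N (T v)) + H v) - (K (N (T u)) + H u)" using T by metis
      then show ?thesis by (simp add: linear_diff[OF K(1)])
    qed
    have "ip ?w ?e = ip (K ?w) ?w + ip ?w ?h"
      unfolding e ip_add_right[OF ip] by (simp add: ip_commute[OF ip])
    then have main: "c * (norm ?w)\<^sup>2 + m * (norm ?e)\<^sup>2 \<le> norm ?w * norm ?h"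
      using K(3)[of ?w] N(2)[of "T v" "T u"] ip_Cauchy_Schwarz[OF ip, of ?w ?h] by linarith
    have nonneg: "0 \<le> m * (norm ?e)\<^sup>2" "0 \<le> c * (norm ?w)\<^sup>2" using N(1) K(2) by simp_all
    have "c * (norm ?w)\<^sup>2 \<le> norm ?w * norm ?h" using main nonneg(1) by linarith
    then have "c * norm ?w * norm ?w \<le> norm ?h * norm ?w" by (simp add: power2_eq_square mult_ac)
    then have "c * norm ?w \<le> norm ?h"
      by (cases "norm ?w = 0") (auto simp: mult_le_cancel_right)
    then have "c * norm ?w * norm ?h \<le> norm ?h * norm ?h" by (rule mult_right_mono) simp
    moreover have "c * (m * (norm ?e)\<^sup>2) \<le> c * (norm ?w * norm ?h)"
      using main nonneg(2) K(2) by (intro mult_left_mono) linarith+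
    ultimately have "c * m * (norm ?e)\<^sup>2 \<le> (norm ?h)\<^sup>2" by (simp add: power2_eq_square mult_ac)
    then show ?thesis
      using K(2) N(1) by (intro real_le_rsqrt) (simp add: field_simps)
  qed
  have "(\<lambda>n. sqrt ((norm (H (s n) - H u))\<^sup>2 / (c * m))) \<longlonglongrightarrow> sqrt ((norm (0::'x))\<^sup>2 / (c * m))"
    using lim K(2) N(1) by (intro tendsto_intros) (auto simp: LIM_zero)
  then have "(\<lambda>n. sqrt ((norm (H (s n) - H u))\<^sup>2 / (c * m))) \<longlonglongrightarrow> 0" by simp
  then have "(\<lambda>n. T (s n) - T u) \<longlonglongrightarrow> 0"
    by (rule Lim_null_comparison[rotated]) (simp add: bound)
  then show "(\<lambda>n. T (s n)) \<longlonglongrightarrow> T u" by (rule LIM_zero_cancel)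
qed

section \<open>Existence of an optimal pair\<close>

text \<open>
  The direct method. Complete continuity of \<open>T\<close> turns weak convergence of the controls into
  convergence of the pairs (control, state) in exactly the topology in which \<open>\<phi>\<close> is lower
  semicontinuous. The infimum is taken in the extended reals, so that the argument also excludes the
  value \<open>-\<infinity>\<close>.
\<close>

lemma weakly_lsc_coercive_attains_infimum:
  fixes T :: "'z::real_normed_vector \<Rightarrow> 'x::real_normed_vector" and \<phi> :: "'z \<Rightarrow> 'x \<Rightarrow> real"
  assumes refl: "reflexive_space TYPE('z)" and T: "completely_continuous T"
    and lsc: "lower_semicontinuous_map (prod_topology weak_topology (top_of_set (range T)))
           (\<lambda>(u, x). \<phi> u x)"
    and coercive: "filterlim (\<lambda>u. \<phi> u (T u)) at_top at_infinity"
  shows "\<exists>u. ereal (\<phi> u (T u)) = (INF u. ereal (\<phi> u (T u)))"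
proof -
  let ?J = "\<lambda>u. \<phi> u (T u)"
  have INF_le: "(INF u. ereal (?J u)) \<le> ereal (?J u)" for u by (rule INF_lower) simp
  show ?thesis
  proof (cases "ereal (?J 0) = (INF u. ereal (?J u))")
    case True
    then show ?thesis by blast
  next
    case False
    obtain w where w: "\<And>n. w n \<in> range (\<lambda>u. ereal (?J u))" "w \<longlonglongrightarrow> (INF u. ereal (?J u))"
      using Inf_as_limit[of "range (\<lambda>u. ereal (?J u))"] by auto
    then have "\<forall>n. \<exists>v. w n = ereal (?J v)" by auto
    then obtain v where v: "\<And>n. w n = ereal (?J (v n))" by metis
    \<comment> \<open>Discarding an initial segment, the minimising controls do better than the control \<open>0\<close>, so
        coercivity bounds them.\<close>
    have INF_less: "(INF u. ereal (?J u)) < ereal (?J 0)" using False INF_le[of 0] by simp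
    have "\<forall>\<^sub>F n in sequentially. w n < ereal (?J 0)"
      by (rule order_tendstoD(2)[OF w(2) INF_less])
    then obtain N where N: "\<And>n. N \<le> n \<Longrightarrow> ?J (v n) < ?J 0"
      by (auto simp: eventually_sequentially v)
    let ?z = "\<lambda>n. v (n + N)"
    have z: "(\<lambda>n. ereal (?J (?z n))) \<longlonglongrightarrow> (INF u. ereal (?J u))"
      using LIMSEQ_ignore_initial_segment[OF w(2), of N] by (simp add: v)
    obtain B where B: "\<And>u. B \<le> norm u \<Longrightarrow> ?J 0 < ?J u"
      using coercive by (auto simp: filterlim_at_top_dense eventually_at_infinity)
    have "norm (?z n) \<le> B" for n
      using N[of "n + N"] B[of "?z n"] by fastforce
    then have "\<exists>r u. strict_mono r \<and> limitin weak_topology (?z \<circ> r) u sequentially"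
      by (rule reflexive_bounded_weakly_convergent_subsequence[OF refl])
    then obtain r u where r: "strict_mono r" and u: "limitin weak_topology (?z \<circ> r) u sequentially"
      by blast
    have "(\<lambda>n. T ((?z \<circ> r) n)) \<longlonglongrightarrow> T u"
      using T u unfolding completely_continuous_def by blast
    then have lim: "limitin (prod_topology weak_topology (top_of_set (range T)))
        (\<lambda>n. (?z (r n), T (?z (r n)))) (u, T u) sequentially"
      using u by (simp add: limitin_pairwise limitin_subtopology comp_def)
    \<comment> \<open>Lower semicontinuity: the set where \<open>\<phi>\<close> exceeds \<open>a\<close> is a neighbourhood of the limit pair.\<close>
    have above: "\<forall>\<^sub>F n in sequentially. a < ?J (?z (r n))" if a: "a < ?J u" for a
    proof -
      let ?X = "prod_topology weak_topology (top_of_set (range T))"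
      let ?U = "{p \<in> topspace ?X. a < (case p of (u, x) \<Rightarrow> \<phi> u x)}"
      have "openin ?X ?U" using lsc unfolding lower_semicontinuous_map_def by blast
      moreover have "(u, T u) \<in> ?U" using limitin_topspace[OF lim] a by simp
      ultimately have "\<forall>\<^sub>F n in sequentially. (?z (r n), T (?z (r n))) \<in> ?U"
        using lim unfolding limitin_def by blast
      then show ?thesis by eventually_elim simp
    qed
    have "ereal (?J u) \<le> (INF u. ereal (?J u))"
    proof (rule ccontr)
      assume "\<not> ?thesis"
      then obtain a where a: "(INF u. ereal (?J u)) < ereal a" "ereal a < ereal (?J u)"
        using ereal_dense2[of "INF u. ereal (?J u)" "ereal (?J u)"] by (auto simp: not_le)
      have "(\<lambda>n. ereal (?J (?z (r n)))) \<longlonglongrightarrow> (INF u. ereal (?J u))"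
        using LIMSEQ_subseq_LIMSEQ[OF z r] by (simp add: comp_def)
      then have "\<forall>\<^sub>F n in sequentially. ereal (?J (?z (r n))) < ereal a"
        using a(1) by (rule order_tendstoD(2))
      moreover have "\<forall>\<^sub>F n in sequentially. a < ?J (?z (r n))" using above a(2) by simp
      ultimately have "\<forall>\<^sub>F n in sequentially. False" by eventually_elim simp
      then show False by simp
    qed
    then show ?thesis using INF_le by (blast intro: antisym)
  qed
qed

theorem theorem3p5:
  fixes K :: "('x::banach \<Rightarrow>\<^sub>L real) \<Rightarrow> 'x"
    and N :: "'x \<Rightarrow> ('x \<Rightarrow>\<^sub>L real)"
    and H :: "'z::banach \<Rightarrow> 'x"
    and T :: "'z \<Rightarrow> 'x"
    and \<phi> :: "'z \<Rightarrow> 'x \<Rightarrow> real"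
  assumes "reflexive_space TYPE('x)" and "reflexive_space TYPE('z)"
    and "\<And>u. \<exists>!x. x = K (N x) + H u"
    and "T = solution_operator K N H"
    and "condition_set_A K N H \<or> condition_set_B K N H"
    and "lower_semicontinuous_map (prod_topology weak_topology (top_of_set (range T)))
           (\<lambda>(u, x). \<phi> u x)"
    and "filterlim (\<lambda>u. \<phi> u (T u)) at_top at_infinity"
  shows "\<exists>u_opt x_opt. x_opt = T u_opt \<and>
           ereal (\<phi> u_opt x_opt) = (INF u. ereal (\<phi> u (T u)))"
proof -
  have T: "T u = K (N (T u)) + H u" for u
    unfolding assms(4) solution_operator_def by (rule theI'[OF assms(3)])
  from assms(5) have "completely_continuous T"
  proof
    assume A: "condition_set_A K N H"
    then obtain d where "0 < d" "\<And>f. d * (norm (K f))\<^sup>2 \<le> blinfun_apply f (K f)"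
      unfolding condition_set_A_def by blast
    then show ?thesis
      using A unfolding condition_set_A_def compact_linear_operator_def
      by (intro completely_continuous_solution_of_monotone_equation[where K = K and N = N and H = H and T = T,
            OF _ _ _ _ _ _ T]) auto
  next
    assume "condition_set_B K N H"
    then obtain ip where ip: "inner_product_for_norm ip" and K: "linear K"
      and K_class: "(\<lambda>x. K (riesz_map ip x)) \<in> class_M ip"
      and N_mu: "0 < mu ip (\<lambda>x. - inv (riesz_map ip) (N x))"
      and H: "completely_continuous H"
      unfolding condition_set_B_def Let_def by blast
    let ?K = "\<lambda>x. K (riesz_map ip x)" and ?N = "\<lambda>x. inv (riesz_map ip) (N x)"
    have linear: "linear ?K"
      using linear_compose[OF linear_riesz_map[OF ip] K] by (simp add: comp_def)
    obtain c where c: "0 < c" "\<And>x y. c * (norm (x - y))\<^sup>2 \<le> ip (?K x - ?K y) (x - y)"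
      using K_class unfolding class_M_def by blast
    \<comment> \<open>Strong monotonicity of a linear map is coercivity of its quadratic form.\<close>
    have K_ip: "c * (norm x)\<^sup>2 \<le> ip (?K x) x" for x
      using c(2)[of x 0] linear_0[OF linear] by simp
    obtain m where m: "0 < m" "\<And>x y. m * (norm (x - y))\<^sup>2 \<le> ip (- ?N x - - ?N y) (x - y)"
      using mu_positive_imp_strongly_monotone[OF ip N_mu] by blast
    have N_ip: "m * (norm (x - y))\<^sup>2 \<le> - ip (?N x - ?N y) (x - y)" for x y
      using m(2)[of x y] ip_minus_left[OF ip, of "?N x - ?N y" "x - y"] by simp
    \<comment> \<open>Surjectivity of the Riesz map makes the dual cancel from \<open>K N\<close>: the state equation is one in the
        Hilbert space itself.\<close>
    have "T u = ?K (?N (T u)) + H u" for u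
      using T[of u] surj_f_inv_f[OF riesz_map_surj[OF ip assms(1)]] by simp
    then show ?thesis
      by (rule completely_continuous_solution_of_strongly_monotone_equation[where T = T, OF ip linear c(1) K_ip m(1) N_ip H])
  qed
  from weakly_lsc_coercive_attains_infimum[OF assms(2) this assms(6,7)] show ?thesis by blast
qed

end
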